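(* Let $\Gamma$ be a finite simple graph and $G=G(\Gamma)$. The subgroup $\operatorname{Conj}_{\operatorname{N}}(G)$ is a normal subgroup of $\operatorname{St}^{\operatorname{conj}}(\mathcal{K})$, and therefore of $\operatorname{Conj}(G)$.
   Context: $\Gamma$ is a finite, undirected, simple graph with vertex set $X$. The partially commutative group $G=G(\Gamma)$ has presentation $\langle X\mid [x,y]=1 \text{ whenever } x,y\in X \text{ are joined by an edge of }\Gamma\rangle$. For $Y\subseteq X$, $G(Y)$ is the subgroup of $G$ generated by $Y$. Conventions: automorphisms act on the right; $g^h=h^{-1}gh$ and $H^h=h^{-1}Hh$. For $Y\subseteq X$, $Y^\perp=\{u\in X: d(u,y)\le 1 \text{ for all } y\in Y\}$ ($d$ the graph distance), $\emptyset^\perp=X$, $x^\perp=\{x\}^\perp$, and $x^\perp\backslash x$ means $x^\perp\backslash\{x\}$. $\mathfrak{a}(\emptyset)=X$ and, for $\emptyset\ne Y\subseteq X$, $\mathfrak{a}(Y)=\bigcap_{y\in Y}(y^\perp\backslash y)^\perp$; $\mathfrak{a}(x)=\mathfrak{a}(\{x\})$. $\mathcal{K}=\{\mathfrak{a}(Y):Y\subseteq X\}$ is the set of admissible sets. $\operatorname{St}^{\operatorname{conj}}(\mathcal{K})$ is the group of all $\phi\in\operatorname{Aut}(G)$ such that for every $Y\in\mathcal{K}$ there is $f_Y\in G$ with $G(Y)\phi=G(Y)^{f_Y}$. $\operatorname{Conj}(G)$ is the group of basis-conjugating automorphisms: those $\phi\in\operatorname{Aut}(G)$ such that for every $x\in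 X$ there is $g_x\in G$ with $x\phi=x^{g_x}$. $\operatorname{Conj}_{\operatorname{N}}(G)$ is the subgroup of normal conjugating automorphisms: those $\phi\in\operatorname{Conj}(G)$ such that for every $x\in X$ there exists $f_x\in G$ with $y\phi=y^{f_x}$ for all $y\in\mathfrak{a}(x)$. *)

theory Defs
  imports "Graph_Theory.Graph_Theory" "HOL-Algebra.Bij" "HOL-Algebra.Coset" "HOL-Algebra.Generated_Groups"
begin

section \<open>Groups given by generators and relators\<close>

text \<open>
  A word is a list of signed letters: \<open>(x, True)\<close> stands for \<open>x\<close> and \<open>(x, False)\<close> for its formal
  inverse.
\<close>

type_synonym 'a word = "('a \<times> bool) list"

definition words :: "'a set \<Rightarrow> 'a word set" where
  "words X = lists (X \<times> UNIV)"

inductive pres_eq :: "'a set \<Rightarrow> 'a word set \<Rightarrow> 'a word \<Rightarrow> 'a word \<Rightarrow> bool"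
  for X :: "'a set" and R :: "'a word set" where
  refl: "w \<in> words X \<Longrightarrow> pres_eq X R w w"
| sym: "pres_eq X R u v \<Longrightarrow> pres_eq X R v u"
| trans: "pres_eq X R u v \<Longrightarrow> pres_eq X R v w \<Longrightarrow> pres_eq X R u w"
| append: "pres_eq X R u u' \<Longrightarrow> pres_eq X R v v' \<Longrightarrow> pres_eq X R (u @ v) (u' @ v')"
| cancel: "x \<in> X \<Longrightarrow> pres_eq X R [(x, b), (x, \<not> b)] []"
| relator: "r \<in> R \<Longrightarrow> r \<in> words X \<Longrightarrow> pres_eq X R r []"

definition word_class :: "'a set \<Rightarrow> 'a word set \<Rightarrow> 'a word \<Rightarrow> 'a word set" where
  "word_class X R w = {v. pres_eq X R w v}"

definition presented_group :: "'a set \<Rightarrow> 'a word set \<Rightarrow> 'a word set monoid" where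
  "presented_group X R =
    \<lparr>carrier = word_class X R ` words X,
     mult = (\<lambda>A B. {w. \<exists>u\<in>A. \<exists>v\<in>B. pres_eq X R (u @ v) w}),
     one = word_class X R []\<rparr>"

lemma pres_eq_words: "pres_eq X R u v \<Longrightarrow> u \<in> words X \<and> v \<in> words X"
  by (induction rule: pres_eq.induct) (auto simp: words_def)

lemma word_class_eq_iff:
  assumes "v \<in> words X"
  shows "word_class X R u = word_class X R v \<longleftrightarrow> pres_eq X R u v"
  unfolding word_class_def
  using assms by (auto intro: pres_eq.refl pres_eq.sym pres_eq.trans)

lemma presented_group_mult:
  assumes "u \<in> words X" "v \<in> words X"
  shows "word_class X R u \<otimes>\<^bsub>presented_group X R\<^esub> word_class X R v = word_class X R (u @ v)"
  unfolding presented_group_def word_class_def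
  using assms by (auto intro: pres_eq.refl pres_eq.sym pres_eq.trans pres_eq.append)

lemma pres_eq_inverse:
  assumes "w \<in> words X"
  shows "pres_eq X R (rev (map (\<lambda>(x, b). (x, \<not> b)) w) @ w) []"
  using assms
proof (induction w)
  case Nil
  then show ?case by (auto intro: pres_eq.refl)
next
  case (Cons a w)
  obtain x b where a: "a = (x, b)" by force
  let ?i = "rev (map (\<lambda>(x, b). (x, \<not> b)) w)"
  have w: "w \<in> words X" and x: "x \<in> X" and i: "?i \<in> words X"
    using Cons.prems by (auto simp: words_def a)
  have "pres_eq X R [(x, \<not> b), (x, b)] []"
    using pres_eq.cancel[OF x, of R "\<not> b"] by simp
  then have "pres_eq X R (?i @ ([(x, \<not> b), (x, b)] @ w)) (?i @ ([] @ w))"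
    using w i by (intro pres_eq.append pres_eq.refl)
  then show ?case
    using Cons.IH[OF w] by (auto simp: a intro: pres_eq.trans)
qed

lemma group_presented_group: "group (presented_group X R)"
proof (rule groupI)
  let ?G = "presented_group X R"
  have carr: "carrier ?G = word_class X R ` words X" and one: "\<one>\<^bsub>?G\<^esub> = word_class X R []"
    by (simp_all add: presented_group_def)
  have app: "u @ v \<in> words X \<longleftrightarrow> u \<in> words X \<and> v \<in> words X" and nil: "[] \<in> words X"
    for u v :: "'a word" by (auto simp: words_def)
  show "a \<otimes>\<^bsub>?G\<^esub> b \<in> carrier ?G" if "a \<in> carrier ?G" "b \<in> carrier ?G" for a b
    using that by (auto simp: carr presented_group_mult app)
  show "\<one>\<^bsub>?G\<^esub> \<in> carrier ?G"
    by (auto simp: carr one nil)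
  show "a \<otimes>\<^bsub>?G\<^esub> b \<otimes>\<^bsub>?G\<^esub> c = a \<otimes>\<^bsub>?G\<^esub> (b \<otimes>\<^bsub>?G\<^esub> c)"
    if "a \<in> carrier ?G" "b \<in> carrier ?G" "c \<in> carrier ?G" for a b c
    using that by (auto simp: carr presented_group_mult app)
  show "\<one>\<^bsub>?G\<^esub> \<otimes>\<^bsub>?G\<^esub> a = a" if "a \<in> carrier ?G" for a
    using that by (auto simp: carr one presented_group_mult nil)
  show "\<exists>b\<in>carrier ?G. b \<otimes>\<^bsub>?G\<^esub> a = \<one>\<^bsub>?G\<^esub>" if mem: "a \<in> carrier ?G" for a
  proof -
    obtain w where w: "w \<in> words X" and a: "a = word_class X R w"
      using mem by (auto simp: carr)
    let ?i = "rev (map (\<lambda>(x, b). (x, \<not> b)) w)"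
    have i: "?i \<in> words X" using w by (auto simp: words_def)
    have "word_class X R ?i \<otimes>\<^bsub>?G\<^esub> a = \<one>\<^bsub>?G\<^esub>"
      using pres_eq_inverse[OF w] by (simp add: a one presented_group_mult i w word_class_eq_iff nil)
    then show ?thesis using i by (auto simp: carr)
  qed
qed

section \<open>Partially commutative groups\<close>

text \<open>
  Finite simple graphs are the finite, loop-free, symmetric digraphs of \<^locale>\<open>pair_graph\<close>: an
  undirected edge joining \<open>x\<close> and \<open>y\<close> is the pair of arcs \<open>(x, y)\<close>, \<open>(y, x)\<close>.
\<close>

definition commutator_word :: "'a \<Rightarrow> 'a \<Rightarrow> 'a word" where
  "commutator_word x y = [(x, False), (y, False), (x, True), (y, True)]"

definition pc_group :: "'a pair_pre_digraph \<Rightarrow> 'a word set monoid" where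
  "pc_group \<Gamma> =
    presented_group (pverts \<Gamma>) {commutator_word x y | x y. (x, y) \<in> parcs \<Gamma>}"

definition pc_gen :: "'a pair_pre_digraph \<Rightarrow> 'a \<Rightarrow> 'a word set" where
  "pc_gen \<Gamma> x =
    word_class (pverts \<Gamma>) {commutator_word x y | x y. (x, y) \<in> parcs \<Gamma>} [(x, True)]"

definition pc_subgroup :: "'a pair_pre_digraph \<Rightarrow> 'a set \<Rightarrow> 'a word set set" where
  "pc_subgroup \<Gamma> Y = generate (pc_group \<Gamma>) (pc_gen \<Gamma> ` Y)"

section \<open>Admissible sets\<close>

definition graph_dist :: "'a pair_pre_digraph \<Rightarrow> 'a \<Rightarrow> 'a \<Rightarrow> ereal" where
  "graph_dist \<Gamma> u v = wf_digraph.\<mu> (with_proj \<Gamma>) (\<lambda>_. 1) u v"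

definition perp :: "'a pair_pre_digraph \<Rightarrow> 'a set \<Rightarrow> 'a set" where
  "perp \<Gamma> Y = {u \<in> pverts \<Gamma>. \<forall>y\<in>Y. graph_dist \<Gamma> u y \<le> 1}"

definition adm :: "'a pair_pre_digraph \<Rightarrow> 'a set \<Rightarrow> 'a set" where
  "adm \<Gamma> Y = (if Y = {} then pverts \<Gamma> else (\<Inter>y\<in>Y. perp \<Gamma> (perp \<Gamma> {y} - {y})))"

definition admissible_sets :: "'a pair_pre_digraph \<Rightarrow> 'a set set" where
  "admissible_sets \<Gamma> = {adm \<Gamma> Y | Y. Y \<subseteq> pverts \<Gamma>}"

section \<open>Groups of automorphisms\<close>

text \<open>
  \<open>conj_elt G g h\<close> is $g^h = h^{-1} g h$ and \<open>conj_set G H h\<close> is $H^h = h^{-1} H h$.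

  \<^const>\<open>AutoGroup\<close> composes functions from right to left, whereas automorphisms acting on the right
  compose from left to right. The two groups are opposite to each other, so they have the same
  subgroups, and a subgroup is normal in another for one product exactly when it is for the other.
\<close>

definition conj_elt :: "('g, 'm) monoid_scheme \<Rightarrow> 'g \<Rightarrow> 'g \<Rightarrow> 'g" where
  "conj_elt G g h = inv\<^bsub>G\<^esub> h \<otimes>\<^bsub>G\<^esub> g \<otimes>\<^bsub>G\<^esub> h"

definition conj_set :: "('g, 'm) monoid_scheme \<Rightarrow> 'g set \<Rightarrow> 'g \<Rightarrow> 'g set" where
  "conj_set G H h = (\<lambda>g. conj_elt G g h) ` H"

definition St_conj :: "'a pair_pre_digraph \<Rightarrow> 'a set set \<Rightarrow> ('a word set \<Rightarrow> 'a word set) set" where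
  "St_conj \<Gamma> K =
    {\<phi> \<in> auto (pc_group \<Gamma>). \<forall>Y\<in>K. \<exists>f\<in>carrier (pc_group \<Gamma>).
       \<phi> ` pc_subgroup \<Gamma> Y = conj_set (pc_group \<Gamma>) (pc_subgroup \<Gamma> Y) f}"

definition Conj :: "'a pair_pre_digraph \<Rightarrow> ('a word set \<Rightarrow> 'a word set) set" where
  "Conj \<Gamma> =
    {\<phi> \<in> auto (pc_group \<Gamma>). \<forall>x\<in>pverts \<Gamma>. \<exists>g\<in>carrier (pc_group \<Gamma>).
       \<phi> (pc_gen \<Gamma> x) = conj_elt (pc_group \<Gamma>) (pc_gen \<Gamma> x) g}"

definition Conj_N :: "'a pair_pre_digraph \<Rightarrow> ('a word set \<Rightarrow> 'a word set) set" where
  "Conj_N \<Gamma> =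
    {\<phi> \<in> Conj \<Gamma>. \<forall>x\<in>pverts \<Gamma>. \<exists>f\<in>carrier (pc_group \<Gamma>). \<forall>y\<in>adm \<Gamma> {x}.
       \<phi> (pc_gen \<Gamma> y) = conj_elt (pc_group \<Gamma>) (pc_gen \<Gamma> y) f}"

end

theory Submission
  imports Defs
begin

text \<open>
  Write \<open>\<aa>(x)\<close> for \<open>adm \<Gamma> {x}\<close>, \<open>st x\<close> for \<open>perp \<Gamma> {x}\<close> (a vertex with its neighbours) and \<open>lk x\<close> for
  \<open>st x - {x}\<close>. A normal conjugating automorphism \<open>\<psi>\<close> is conjugation by a single element \<open>k\<close> on
  each subgroup \<open>G(\<aa>(x))\<close>. Suppose an automorphism \<open>\<phi>\<close> sends every \<open>G(\<aa>(x))\<close> into a conjugate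
  \<open>G(\<aa>(x))\<^sup>f\<close>. On such a conjugate \<open>\<psi>\<close> is conjugation by \<open>f\<^sup>-\<^sup>1 k \<psi>(f)\<close>, again a single element,
  and carrying this back along the inverse of \<open>\<phi>\<close> shows that the conjugate of \<open>\<psi>\<close> by \<open>\<phi>\<close> is
  conjugation by a single element on \<open>\<aa>(x)\<close> (\<open>conjugate_pointwise_inner\<close>, \<open>conjugate_Conj_N\<close>).
  Elements of \<open>St_conj\<close> have the required property of \<open>\<phi>\<close> by definition, because \<open>\<aa>(x)\<close> is
  admissible. \<open>Conj_N\<close> lies in \<open>St_conj\<close> because a nonempty \<open>Y\<close> containing \<open>y\<close> has
  \<open>\<aa>(Y) \<subseteq> \<aa>(y)\<close>.

  What remains is that every basis-conjugating automorphism has this property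
  (\<open>Conj_preserves_adm\<close>). The reason is that \<open>\<aa>(x)\<close> is \<open>perp\<close> of \<open>lk x\<close>, so that \<open>G(\<aa>(x))\<close> is the
  centralizer of \<open>G(lk x)\<close>. Up to an inner automorphism \<open>\<phi>\<close> fixes \<open>x\<close>; it then preserves the
  centralizer \<open>G(st x)\<close> of \<open>x\<close>. For \<open>u\<close> in \<open>lk x\<close>, the retraction onto \<open>G(st x)\<close> lets the element
  that conjugates \<open>u\<close> to its image be chosen in \<open>G(st x)\<close>, where \<open>G(lk x)\<close> is normal; so the
  image of \<open>u\<close> stays in \<open>G(lk x)\<close>. Applied to the inverse of \<open>\<phi>\<close>, this shows that \<open>\<phi>\<close> maps the
  centralizer of \<open>G(lk x)\<close> into itself.

  The combinatorial input is that the centralizer of a generator \<open>x\<close> is \<open>G(st x)\<close>. Instead of normal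
  forms for words, \<open>centralizer_gen\<close> uses one permutation representation of the group, obtained from
  the universal property of the presentation. Intersections of the subgroups \<open>G(Y)\<close> are computed with
  retractions (\<open>sub_Int\<close>), which gives centralizers of sets of generators.
\<close>

section \<open>Automorphisms that agree with inner automorphisms\<close>

context group
begin

lemma conj_elt_closed [simp]:
  "a \<in> carrier G \<Longrightarrow> f \<in> carrier G \<Longrightarrow> conj_elt G a f \<in> carrier G"
  by (simp add: conj_elt_def)

lemma conj_elt_conj_elt:
  assumes "a \<in> carrier G" "f \<in> carrier G" "h \<in> carrier G"
  shows "conj_elt G (conj_elt G a f) h = conj_elt G a (f \<otimes> h)"
  using assms by (simp add: conj_elt_def m_assoc inv_mult_group)

lemma conj_elt_one [simp]: "a \<in> carrier G \<Longrightarrow> conj_elt G a \<one> = a"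
  by (simp add: conj_elt_def)

lemma conj_elt_cancel [simp]:
  assumes "a \<in> carrier G" "f \<in> carrier G"
  shows "conj_elt G (conj_elt G a f) (inv f) = a" "conj_elt G (conj_elt G a (inv f)) f = a"
  using assms by (simp_all add: conj_elt_conj_elt)

lemma conj_elt_eq_self_iff:
  assumes "a \<in> carrier G" "f \<in> carrier G"
  shows "conj_elt G a f = a \<longleftrightarrow> a \<otimes> f = f \<otimes> a"
  using assms by (metis conj_elt_def inv_closed inv_solve_left m_assoc m_closed)

lemma conj_elt_hom:
  assumes f: "f \<in> carrier G"
  shows "(\<lambda>a. conj_elt G a f) \<in> hom G G"
proof -
  have "f \<otimes> (inv f \<otimes> c) = c" if "c \<in> carrier G" for c
    using that f by (simp add: m_assoc[symmetric])
  then show ?thesis using f by (auto simp: hom_def conj_elt_def m_assoc)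
qed

lemma hom_conj_elt:
  assumes "\<phi> \<in> hom G G" "a \<in> carrier G" "f \<in> carrier G"
  shows "\<phi> (conj_elt G a f) = conj_elt G (\<phi> a) (\<phi> f)"
proof -
  interpret \<phi>: group_hom G G \<phi>
    using assms(1) by unfold_locales
  show ?thesis using assms(2,3) by (simp add: conj_elt_def)
qed

lemma conj_set_conj_set:
  assumes "H \<subseteq> carrier G" "f \<in> carrier G" "h \<in> carrier G"
  shows "conj_set G (conj_set G H f) h = conj_set G H (f \<otimes> h)"
  unfolding conj_set_def image_image
  by (rule image_cong) (use assms in \<open>auto simp: conj_elt_conj_elt\<close>)

lemma conj_set_one: "H \<subseteq> carrier G \<Longrightarrow> conj_set G H \<one> = H"
  unfolding conj_set_def by (auto simp: image_iff subset_iff)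

lemma hom_conj_set:
  assumes "\<phi> \<in> hom G G" "H \<subseteq> carrier G" "f \<in> carrier G"
  shows "\<phi> ` conj_set G H f = conj_set G (\<phi> ` H) (\<phi> f)"
  unfolding conj_set_def image_image
  by (rule image_cong) (use assms in \<open>auto simp: hom_conj_elt\<close>)

lemma autoD:
  assumes "\<phi> \<in> auto G"
  shows "\<phi> \<in> hom G G" "a \<in> carrier G \<Longrightarrow> \<phi> a \<in> carrier G"
  using assms by (auto simp: auto_def hom_def)

lemma auto_mult:
  assumes "\<phi> \<in> auto G" "\<psi> \<in> auto G"
  shows "\<phi> \<otimes>\<^bsub>AutoGroup G\<^esub> \<psi> = compose (carrier G) \<phi> \<psi>"
  using assms by (simp add: AutoGroup_def BijGroup_def auto_def)

lemma carrier_AutoGroup [simp]: "carrier (AutoGroup G) = auto G"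
  by (simp add: AutoGroup_def)

lemma auto_inv:
  assumes "\<phi> \<in> auto G"
  shows "inv\<^bsub>AutoGroup G\<^esub> \<phi> \<in> auto G"
    and "a \<in> carrier G \<Longrightarrow> (inv\<^bsub>AutoGroup G\<^esub> \<phi>) (\<phi> a) = a"
    and "a \<in> carrier G \<Longrightarrow> \<phi> ((inv\<^bsub>AutoGroup G\<^esub> \<phi>) a) = a"
proof -
  interpret A: group "AutoGroup G" by (rule AutoGroup)
  let ?\<theta> = "inv\<^bsub>AutoGroup G\<^esub> \<phi>"
  show \<theta>: "?\<theta> \<in> auto G" using A.inv_closed assms by simp
  have one: "\<one>\<^bsub>AutoGroup G\<^esub> = (\<lambda>x\<in>carrier G. x)"
    by (simp add: AutoGroup_def BijGroup_def)
  show "?\<theta> (\<phi> a) = a" if "a \<in> carrier G"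
    using A.l_inv[of \<phi>] that assms \<theta> one by (auto simp: auto_mult compose_def fun_eq_iff split: if_splits)
  show "\<phi> (?\<theta> a) = a" if "a \<in> carrier G"
    using A.r_inv[of \<phi>] that assms \<theta> one by (auto simp: auto_mult compose_def fun_eq_iff split: if_splits)
qed

lemma subgroup_AutoGroupI:
  assumes "\<And>\<phi>. P \<phi> \<Longrightarrow> \<phi> \<in> auto G"
    and "P (\<lambda>a\<in>carrier G. a)"
    and "\<And>\<phi> \<psi>. P \<phi> \<Longrightarrow> P \<psi> \<Longrightarrow> compose (carrier G) \<phi> \<psi> \<in> auto G
      \<Longrightarrow> P (compose (carrier G) \<phi> \<psi>)"
    and "\<And>\<phi>. P \<phi> \<Longrightarrow> P (inv\<^bsub>AutoGroup G\<^esub> \<phi>)"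
  shows "subgroup (Collect P) (AutoGroup G)"
proof -
  interpret A: group "AutoGroup G" by (rule AutoGroup)
  show ?thesis
  proof
    show "\<phi> \<otimes>\<^bsub>AutoGroup G\<^esub> \<psi> \<in> Collect P" if "\<phi> \<in> Collect P" "\<psi> \<in> Collect P" for \<phi> \<psi>
    proof -
      have P: "P \<phi>" "P \<psi>" using that by simp_all
      then have "\<phi> \<otimes>\<^bsub>AutoGroup G\<^esub> \<psi> = compose (carrier G) \<phi> \<psi>" "\<phi> \<otimes>\<^bsub>AutoGroup G\<^esub> \<psi> \<in> auto G"
        using auto_mult[OF assms(1)[OF P(1)] assms(1)[OF P(2)]] A.m_closed[of \<phi> \<psi>] assms(1) by simp_all
      then show ?thesis using assms(3)[OF P] by simp
    qed
    show "\<one>\<^bsub>AutoGroup G\<^esub> \<in> Collect P"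
      using assms(2) by (simp add: AutoGroup_def BijGroup_def)
  qed (use assms(1,4) in auto)
qed

text \<open>
  An automorphism carries conjugation by \<open>f\<close> to conjugation by its value at \<open>f\<close>: if \<open>\<psi>\<close> is conjugation by \<open>f\<close> on \<open>A\<close> and \<open>\<phi>\<close> is
  conjugation by \<open>h\<close> on \<open>A\<close>, then \<open>\<phi> \<circ> \<psi>\<close> is conjugation by \<open>h \<phi>(f)\<close> on \<open>A\<close>, and the inverse \<open>\<theta>\<close> of \<open>\<phi>\<close>
  is conjugation by the inverse of \<open>\<theta>(h)\<close> on \<open>A\<close>. With singletons of
  generators for \<open>A\<close> this covers \<open>Conj\<close>, with the admissible sets of single vertices \<open>Conj_N\<close>.
\<close>

lemma subgroup_pointwise_inner:
  assumes F: "\<And>A. A \<in> F \<Longrightarrow> A \<subseteq> carrier G"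
  shows "subgroup {\<phi> \<in> auto G. \<forall>A\<in>F. \<exists>f\<in>carrier G. \<forall>a\<in>A. \<phi> a = conj_elt G a f} (AutoGroup G)"
proof (rule subgroup_AutoGroupI, goal_cases)
  case (1 \<phi>)
  then show ?case by simp
next
  case 2
  have "\<exists>f\<in>carrier G. \<forall>a\<in>A. (\<lambda>a\<in>carrier G. a) a = conj_elt G a f" if "A \<in> F" for A
    using F[OF that] by (intro bexI[of _ \<one>]) (auto simp: subset_iff)
  then show ?case using id_in_auto by blast
next
  case (3 \<phi> \<psi>)
  have "\<exists>f\<in>carrier G. \<forall>a\<in>A. compose (carrier G) \<phi> \<psi> a = conj_elt G a f" if "A \<in> F" for A
  proof -
    have A: "A \<subseteq> carrier G" using F that .
    obtain f where f: "f \<in> carrier G" "\<forall>a\<in>A. \<psi> a = conj_elt G a f" using 3 \<open>A \<in> F\<close> by blast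
    obtain h where h: "h \<in> carrier G" "\<forall>a\<in>A. \<phi> a = conj_elt G a h" using 3 \<open>A \<in> F\<close> by blast
    have \<phi>: "\<phi> \<in> auto G" using 3 by blast
    have "compose (carrier G) \<phi> \<psi> a = conj_elt G a (h \<otimes> \<phi> f)" if "a \<in> A" for a
      using that A f h autoD[OF \<phi>] by (auto simp: compose_def subset_iff hom_conj_elt conj_elt_conj_elt)
    then show ?thesis using f h autoD[OF \<phi>] by blast
  qed
  then show ?case using 3 by simp
next
  case (4 \<phi>)
  let ?\<theta> = "inv\<^bsub>AutoGroup G\<^esub> \<phi>"
  have \<phi>: "\<phi> \<in> auto G" using 4 by blast
  note \<theta> = auto_inv[OF \<phi>]
  note \<theta>D = autoD[OF \<theta>(1)]
  have "\<exists>f\<in>carrier G. \<forall>a\<in>A. ?\<theta> a = conj_elt G a f" if "A \<in> F" for A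
  proof -
    have A: "A \<subseteq> carrier G" using F that .
    obtain f where f: "f \<in> carrier G" "\<forall>a\<in>A. \<phi> a = conj_elt G a f" using 4 \<open>A \<in> F\<close> by blast
    have "?\<theta> a = conj_elt G a (inv (?\<theta> f))" if "a \<in> A" for a
    proof -
      have a: "a \<in> carrier G" using that A by blast
      have "a = ?\<theta> (conj_elt G a f)" using \<theta>(2)[OF a] f that by simp
      also have "\<dots> = conj_elt G (?\<theta> a) (?\<theta> f)" using hom_conj_elt \<theta>D a f by blast
      finally have "conj_elt G a (inv (?\<theta> f)) = conj_elt G (conj_elt G (?\<theta> a) (?\<theta> f)) (inv (?\<theta> f))"
        by simp
      then show ?thesis using \<theta>D(2)[OF a] \<theta>D(2)[OF f(1)] by simp
    qed
    then show ?thesis using \<theta>D(2)[OF f(1)] by blast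
  qed
  then show ?case using \<theta> by simp
qed

text \<open>
  The same conjugators \<open>h \<phi>(f)\<close> and inverse of \<open>\<theta>(h)\<close> work for images of sets, as in \<open>St_conj\<close>.
\<close>

lemma subgroup_setwise_inner:
  assumes F: "\<And>H. H \<in> F \<Longrightarrow> H \<subseteq> carrier G"
  shows "subgroup {\<phi> \<in> auto G. \<forall>H\<in>F. \<exists>f\<in>carrier G. \<phi> ` H = conj_set G H f} (AutoGroup G)"
proof (rule subgroup_AutoGroupI, goal_cases)
  case (1 \<phi>)
  then show ?case by simp
next
  case 2
  have "\<exists>f\<in>carrier G. (\<lambda>a\<in>carrier G. a) ` H = conj_set G H f" if "H \<in> F" for H
    using F[OF that] by (intro bexI[of _ \<one>]) (auto simp: conj_set_one)
  then show ?case using id_in_auto by blast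
next
  case (3 \<phi> \<psi>)
  have "\<exists>f\<in>carrier G. compose (carrier G) \<phi> \<psi> ` H = conj_set G H f" if H_in: "H \<in> F" for H
  proof -
    have H: "H \<subseteq> carrier G" using F H_in .
    obtain f where f: "f \<in> carrier G" "\<psi> ` H = conj_set G H f" using bspec[OF conjunct2[OF 3(2)] H_in] by blast
    obtain h where h: "h \<in> carrier G" "\<phi> ` H = conj_set G H h" using bspec[OF conjunct2[OF 3(1)] H_in] by blast
    have \<phi>: "\<phi> \<in> auto G" using 3 by blast
    have "compose (carrier G) \<phi> \<psi> ` H = \<phi> ` (\<psi> ` H)"
      using H by (force simp: compose_def image_iff)
    also have "\<dots> = conj_set G H (h \<otimes> \<phi> f)"
      using H f h autoD[OF \<phi>] by (simp only: hom_conj_set conj_set_conj_set)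
    finally show ?thesis using f(1) h(1) autoD(2)[OF \<phi>] by (intro bexI[of _ "h \<otimes> \<phi> f"]) auto
  qed
  then show ?case using 3 by simp
next
  case (4 \<phi>)
  let ?\<theta> = "inv\<^bsub>AutoGroup G\<^esub> \<phi>"
  have \<phi>: "\<phi> \<in> auto G" using 4 by blast
  note \<theta> = auto_inv[OF \<phi>]
  note \<theta>D = autoD[OF \<theta>(1)]
  have "\<exists>f\<in>carrier G. ?\<theta> ` H = conj_set G H f" if H_in: "H \<in> F" for H
  proof -
    have H: "H \<subseteq> carrier G" using F H_in .
    then have \<theta>H: "?\<theta> ` H \<subseteq> carrier G" using \<theta>D by blast
    obtain f where f: "f \<in> carrier G" "\<phi> ` H = conj_set G H f" using bspec[OF conjunct2[OF 4] H_in] by blast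
    have "H = ?\<theta> ` (\<phi> ` H)"
      using \<theta>(2) H by (auto simp: image_image subset_iff intro!: image_cong[of H H "\<lambda>a. a", simplified])
    also have "\<dots> = conj_set G (?\<theta> ` H) (?\<theta> f)" unfolding f(2) by (rule hom_conj_set[OF \<theta>D(1) H f(1)])
    finally have "conj_set G H (inv (?\<theta> f)) = conj_set G (conj_set G (?\<theta> ` H) (?\<theta> f)) (inv (?\<theta> f))"
      by simp
    then have "?\<theta> ` H = conj_set G H (inv (?\<theta> f))"
      using \<theta>H \<theta>D(2)[OF f(1)] by (simp add: conj_set_conj_set conj_set_one)
    then show ?thesis using \<theta>D(2)[OF f(1)] by blast
  qed
  then show ?case using \<theta> by simp
qed

lemma hom_eq_on_generate:
  assumes "group H" "h \<in> hom G H" "k \<in> hom G H" "S \<subseteq> carrier G"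
    and "\<And>s. s \<in> S \<Longrightarrow> h s = k s" "g \<in> generate G S"
  shows "h g = k g"
  using \<open>g \<in> generate G S\<close>
proof induction
  interpret h: group_hom G H h using assms by (simp add: group_hom_def group_hom_axioms_def)
  interpret k: group_hom G H k using assms by (simp add: group_hom_def group_hom_axioms_def)
  {
    case one
    show ?case by simp
  next
    case (incl s)
    then show ?case using assms by simp
  next
    case (inv s)
    then show ?case using assms by (auto simp: subset_iff)
  next
    case (eng a b)
    then show ?case using generate_in_carrier[OF \<open>S \<subseteq> carrier G\<close>] by simp
  }
qed

text \<open>
  Conjugation by \<open>h\<close> is a homomorphism that agrees with the identity on \<open>S\<close>.
\<close>

lemma commutes_generate:
  assumes "S \<subseteq> carrier G" "h \<in> carrier G" "\<And>s. s \<in> S \<Longrightarrow> s \<otimes> h = h \<otimes> s" "g \<in> generate G S"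
  shows "g \<otimes> h = h \<otimes> g"
proof -
  have "(\<lambda>a. conj_elt G a h) \<in> hom G G"
    using assms by (simp add: conj_elt_hom)
  moreover have "(\<lambda>a. a) \<in> hom G G" by (simp add: hom_def)
  moreover have "conj_elt G s h = s" if "s \<in> S" for s
    using assms that by (auto simp: conj_elt_eq_self_iff)
  ultimately have "conj_elt G g h = g"
    using hom_eq_on_generate[OF is_group _ _ assms(1) _ assms(4), of "\<lambda>a. conj_elt G a h" "\<lambda>a. a"] by simp
  then show ?thesis using conj_elt_eq_self_iff generate_in_carrier assms by simp
qed

lemma pointwise_inner_generate:
  assumes "\<psi> \<in> hom G G" "S \<subseteq> carrier G" "f \<in> carrier G"
    and "\<And>s. s \<in> S \<Longrightarrow> \<psi> s = conj_elt G s f" "g \<in> generate G S"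
  shows "\<psi> g = conj_elt G g f"
proof -
  have "(\<lambda>a. conj_elt G a f) \<in> hom G G"
    using assms by (simp add: conj_elt_hom)
  then show ?thesis
    using hom_eq_on_generate[OF is_group assms(1) _ assms(2) _ assms(5)] assms(4) by simp
qed

text \<open>
  The heart of both normality statements. If \<open>\<phi>(a) = h\<^sup>f\<close> with \<open>h\<close> in \<open>H\<close>, then
  \<open>\<psi>(\<phi>(a))\<close> is the conjugate of \<open>h\<close> by \<open>k \<psi>(f)\<close>, hence the conjugate of \<open>\<phi>(a)\<close> by \<open>m = f\<^sup>-\<^sup>1 k \<psi>(f)\<close>. This \<open>m\<close> does not depend
  on \<open>a\<close>, and neither does its preimage under \<open>\<phi>\<close>, by which \<open>a\<close> is conjugated in the end.
\<close>

lemma conjugate_pointwise_inner: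
  assumes \<phi>: "\<phi> \<in> auto G" and \<psi>: "\<psi> \<in> auto G"
    and A: "A \<subseteq> carrier G" and H: "H \<subseteq> carrier G" "f \<in> carrier G" "k \<in> carrier G"
    and img: "\<And>a. a \<in> A \<Longrightarrow> \<phi> a \<in> conj_set G H f"
    and inner: "\<And>h. h \<in> H \<Longrightarrow> \<psi> h = conj_elt G h k"
  shows "\<exists>m\<in>carrier G. \<forall>a\<in>A. (inv\<^bsub>AutoGroup G\<^esub> \<phi>) (\<psi> (\<phi> a)) = conj_elt G a m"
proof -
  let ?\<theta> = "inv\<^bsub>AutoGroup G\<^esub> \<phi>"
  let ?m = "inv f \<otimes> (k \<otimes> \<psi> f)"
  note \<theta> = auto_inv[OF \<phi>]
  note D = autoD[OF \<phi>] autoD[OF \<psi>] autoD[OF \<theta>(1)]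
  have m: "?m \<in> carrier G" using H D by simp
  have "?\<theta> (\<psi> (\<phi> a)) = conj_elt G a (?\<theta> ?m)" if "a \<in> A" for a
  proof -
    have a: "a \<in> carrier G" "\<phi> a \<in> carrier G" using that A D by auto
    obtain h where h: "h \<in> H" "\<phi> a = conj_elt G h f" using img[OF \<open>a \<in> A\<close>] by (auto simp: conj_set_def)
    have hG: "h \<in> carrier G" using h H by blast
    have "\<psi> (\<phi> a) = conj_elt G (\<psi> h) (\<psi> f)" using hom_conj_elt D h hG H by simp
    also have "\<dots> = conj_elt G h (k \<otimes> \<psi> f)" using inner h hG H D by (simp add: conj_elt_conj_elt)
    also have "\<dots> = conj_elt G (\<phi> a) ?m"
      using h hG H D by (simp add: conj_elt_conj_elt m_assoc[symmetric])
    finally have "\<psi> (\<phi> a) = conj_elt G (\<phi> a) ?m" .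
    then have "?\<theta> (\<psi> (\<phi> a)) = conj_elt G (?\<theta> (\<phi> a)) (?\<theta> ?m)"
      using hom_conj_elt[OF D(5) a(2) m] by simp
    then show ?thesis using \<theta>(2)[OF a(1)] by simp
  qed
  then show ?thesis using D m by blast
qed

lemma normal_in_subgroupI:
  assumes "subgroup H G" "subgroup N G" "N \<subseteq> H"
    and "\<And>h n. h \<in> H \<Longrightarrow> n \<in> N \<Longrightarrow> inv h \<otimes> n \<otimes> h \<in> N"
  shows "N \<lhd> G\<lparr>carrier := H\<rparr>"
proof -
  interpret H: group "G\<lparr>carrier := H\<rparr>"
    using subgroup.subgroup_is_group[OF assms(1) is_group] .
  have "subgroup N (G\<lparr>carrier := H\<rparr>)" using subgroup_incl assms by blast
  moreover have "h \<otimes> n \<otimes> inv h \<in> N" if "h \<in> H" "n \<in> N" for h n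
    using assms(4)[of "inv h" n] that subgroup.m_inv_closed[OF assms(1)] subgroup.mem_carrier[OF assms(1)]
    by simp
  ultimately show ?thesis
    unfolding H.normal_inv_iff using m_inv_consistent[OF assms(1)] by simp
qed

end

section \<open>Homomorphisms out of a presented group\<close>

definition word_eval :: "('g, 'm) monoid_scheme \<Rightarrow> ('a \<Rightarrow> 'g) \<Rightarrow> 'a word \<Rightarrow> 'g" where
  "word_eval H f w = foldr (\<lambda>(x, b) h. (if b then f x else inv\<^bsub>H\<^esub> f x) \<otimes>\<^bsub>H\<^esub> h) w \<one>\<^bsub>H\<^esub>"

lemma word_eval_simps [simp]:
  "word_eval H f [] = \<one>\<^bsub>H\<^esub>"
  "word_eval H f ((x, b) # w) = (if b then f x else inv\<^bsub>H\<^esub> f x) \<otimes>\<^bsub>H\<^esub> word_eval H f w"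
  by (simp_all add: word_eval_def)

lemma words_simps [simp]:
  "[] \<in> words X" "(x, b) # w \<in> words X \<longleftrightarrow> x \<in> X \<and> w \<in> words X"
  "u @ v \<in> words X \<longleftrightarrow> u \<in> words X \<and> v \<in> words X"
  by (auto simp: words_def)

context group
begin

lemma word_eval_closed:
  assumes "f \<in> X \<rightarrow> carrier G" "w \<in> words X"
  shows "word_eval G f w \<in> carrier G"
  using assms(2) by (induction w) (use assms(1) in \<open>auto simp: Pi_iff\<close>)

lemma word_eval_append:
  assumes "f \<in> X \<rightarrow> carrier G" "u \<in> words X" "v \<in> words X"
  shows "word_eval G f (u @ v) = word_eval G f u \<otimes> word_eval G f v"
  using assms(2)
proof (induction u)
  case Nil
  then show ?case using word_eval_closed assms by fastforce
next
  case (Cons p u)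
  obtain x b where p: "p = (x, b)" by force
  then show ?case
    using Cons assms word_eval_closed[OF assms(1)] by (auto simp: m_assoc Pi_iff)
qed

lemma word_eval_pres_eq:
  assumes f: "f \<in> X \<rightarrow> carrier G" and R: "\<And>r. r \<in> R \<Longrightarrow> r \<in> words X \<Longrightarrow> word_eval G f r = \<one>"
    and "pres_eq X R u v"
  shows "word_eval G f u = word_eval G f v"
  using assms(3)
proof induction
  case (append u u' v v')
  then show ?case using word_eval_append[OF f] pres_eq_words by metis
next
  case (cancel x b)
  then show ?case using f by (auto simp: Pi_iff)
qed (use R in auto)

end

text \<open>
  The universal property of a presentation: evaluation of words in \<open>H\<close> is constant on word classes
  as soon as it kills the relators.
\<close>

lemma presented_group_hom:
  assumes "group H" and f: "f \<in> X \<rightarrow> carrier H"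
    and R: "\<And>r. r \<in> R \<Longrightarrow> r \<in> words X \<Longrightarrow> word_eval H f r = \<one>\<^bsub>H\<^esub>"
  shows "\<exists>h\<in>hom (presented_group X R) H. \<forall>x\<in>X. h (word_class X R [(x, True)]) = f x"
proof -
  interpret H: group H by fact
  define h where "h A = word_eval H f (SOME w. w \<in> A)" for A
  have h: "h (word_class X R w) = word_eval H f w" if "w \<in> words X" for w
  proof -
    have "pres_eq X R w w" using that by (rule pres_eq.refl)
    then have "pres_eq X R w (SOME v. v \<in> word_class X R w)"
      unfolding word_class_def by (metis mem_Collect_eq someI_ex)
    then show ?thesis unfolding h_def using H.word_eval_pres_eq[OF f R] by metis
  qed
  have "h \<in> hom (presented_group X R) H"
  proof (rule homI)
    fix A B assume "A \<in> carrier (presented_group X R)" "B \<in> carrier (presented_group X R)"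
    then obtain u v where uv: "u \<in> words X" "A = word_class X R u" "v \<in> words X" "B = word_class X R v"
      by (auto simp: presented_group_def)
    then show "h A \<in> carrier H" using h H.word_eval_closed[OF f] by simp
    show "h (A \<otimes>\<^bsub>presented_group X R\<^esub> B) = h A \<otimes>\<^bsub>H\<^esub> h B"
      using uv by (simp add: presented_group_mult h H.word_eval_append[OF f])
  qed
  then show ?thesis using h f by (intro bexI[of _ h]) (auto simp: Pi_iff)
qed

lemma word_eval_word_class:
  assumes "w \<in> words X"
  shows "word_eval (presented_group X R) (\<lambda>x. word_class X R [(x, True)]) w = word_class X R w"
  using assms
proof (induction w)
  case Nil
  show ?case by (simp add: presented_group_def)
next
  case (Cons p w)
  interpret P: group "presented_group X R" by (rule group_presented_group)
  obtain x b where p: "p = (x, b)" by force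
  have x: "x \<in> X" "w \<in> words X" using Cons p by auto
  let ?P = "presented_group X R"
  let ?c = "\<lambda>b. word_class X R [(x, b)]"
  have c: "?c b \<in> carrier ?P" for b using x by (auto simp: presented_group_def)
  have "?c False \<otimes>\<^bsub>?P\<^esub> ?c True = word_class X R []"
    using x pres_eq.cancel[of x X R False] by (simp add: presented_group_mult word_class_eq_iff)
  then have "inv\<^bsub>?P\<^esub> ?c True = ?c False"
    using P.inv_equality c by (simp add: presented_group_def)
  moreover have "word_class X R (p # w) = ?c b \<otimes>\<^bsub>?P\<^esub> word_class X R w"
    using x p by (simp add: presented_group_mult)
  ultimately show ?case using Cons.IH x p by (cases b) simp_all
qed

lemma presented_group_generated:
  "generate (presented_group X R) ((\<lambda>x. word_class X R [(x, True)]) ` X) = carrier (presented_group X R)"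
  (is "generate ?P (?c ` X) = _")
proof
  interpret P: group ?P by (rule group_presented_group)
  show "generate ?P (?c ` X) \<subseteq> carrier ?P"
    by (rule P.generate_incl) (auto simp: presented_group_def)
  have "word_eval ?P ?c w \<in> generate ?P (?c ` X)" if "w \<in> words X" for w
    using that
    by (induction w)
      (auto intro!: generate.one generate.eng imageI intro: generate.incl[OF imageI] generate.inv[OF imageI])
  then have "word_class X R ` words X \<subseteq> generate ?P (?c ` X)"
    by (auto simp: word_eval_word_class)
  then show "carrier ?P \<subseteq> generate ?P (?c ` X)"
    by (simp add: presented_group_def)
qed

lemma (in group) word_eval_commutator_word:
  assumes "f x \<in> carrier G" "f y \<in> carrier G"
  shows "word_eval G f (commutator_word x y) = \<one> \<longleftrightarrow> f x \<otimes> f y = f y \<otimes> f x"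
proof -
  have "word_eval G f (commutator_word x y) = inv (f y \<otimes> f x) \<otimes> (f x \<otimes> f y)"
    using assms by (simp add: commutator_word_def inv_mult_group m_assoc)
  also have "\<dots> = \<one> \<longleftrightarrow> f x \<otimes> f y = f y \<otimes> f x"
    using assms by (metis inv_equality inv_inv m_closed inv_closed r_inv l_inv)
  finally show ?thesis .
qed

section \<open>Partially commutative groups\<close>

locale partially_commutative = pair_graph \<Gamma> for \<Gamma> :: "'a pair_pre_digraph"
begin

abbreviation "PC \<equiv> pc_group \<Gamma>"
abbreviation "gen \<equiv> pc_gen \<Gamma>"
abbreviation "sub \<equiv> pc_subgroup \<Gamma>"
abbreviation "V \<equiv> pverts \<Gamma>"

sublocale PC: group PC
  unfolding pc_group_def by (rule group_presented_group)

lemma gen_closed [simp]: "x \<in> V \<Longrightarrow> gen x \<in> carrier PC"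
  by (auto simp: pc_gen_def pc_group_def presented_group_def)

lemma gen_image_subset: "A \<subseteq> V \<Longrightarrow> gen ` A \<subseteq> carrier PC"
  by auto

lemma pc_group_generated: "generate PC (gen ` V) = carrier PC"
  using presented_group_generated unfolding pc_gen_def pc_group_def by auto

lemma sub_subset: "A \<subseteq> V \<Longrightarrow> sub A \<subseteq> carrier PC"
  unfolding pc_subgroup_def by (rule PC.generate_incl[OF gen_image_subset])

lemma subgroup_sub: "A \<subseteq> V \<Longrightarrow> subgroup (sub A) PC"
  unfolding pc_subgroup_def by (rule PC.generate_is_subgroup[OF gen_image_subset])

lemma gen_in_sub: "x \<in> A \<Longrightarrow> gen x \<in> sub A"
  unfolding pc_subgroup_def by (blast intro: generate.incl)

lemma mem_sub_mult_left:
  assumes "A \<subseteq> V" "a \<in> sub A" "h \<in> carrier PC"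
  shows "a \<otimes>\<^bsub>PC\<^esub> h \<in> sub A \<longleftrightarrow> h \<in> sub A"
proof -
  interpret A: subgroup "sub A" PC using subgroup_sub assms by blast
  have "h = inv\<^bsub>PC\<^esub> a \<otimes>\<^bsub>PC\<^esub> (a \<otimes>\<^bsub>PC\<^esub> h)"
    using assms sub_subset by (auto simp: PC.m_assoc[symmetric] subset_iff)
  then show ?thesis using assms A.m_closed A.m_inv_closed by metis
qed

lemma mem_sub_mult_right:
  assumes "A \<subseteq> V" "a \<in> sub A" "h \<in> carrier PC"
  shows "h \<otimes>\<^bsub>PC\<^esub> a \<in> sub A \<longleftrightarrow> h \<in> sub A"
proof -
  interpret A: subgroup "sub A" PC using subgroup_sub assms by blast
  have "h = (h \<otimes>\<^bsub>PC\<^esub> a) \<otimes>\<^bsub>PC\<^esub> inv\<^bsub>PC\<^esub> a"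
    using assms sub_subset by (auto simp: PC.m_assoc subset_iff)
  then show ?thesis using assms A.m_closed A.m_inv_closed by metis
qed

lemma commutes_sub:
  assumes "A \<subseteq> V" "h \<in> carrier PC" "\<And>y. y \<in> A \<Longrightarrow> gen y \<otimes>\<^bsub>PC\<^esub> h = h \<otimes>\<^bsub>PC\<^esub> gen y" "g \<in> sub A"
  shows "g \<otimes>\<^bsub>PC\<^esub> h = h \<otimes>\<^bsub>PC\<^esub> g"
  by (rule PC.commutes_generate[OF gen_image_subset[OF assms(1)] assms(2)])
    (use assms(3,4) in \<open>auto simp: pc_subgroup_def\<close>)

lemma gen_commute:
  assumes "(x, y) \<in> parcs \<Gamma>"
  shows "gen x \<otimes>\<^bsub>PC\<^esub> gen y = gen y \<otimes>\<^bsub>PC\<^esub> gen x"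
proof -
  let ?R = "{commutator_word x y | x y. (x, y) \<in> parcs \<Gamma>}"
  have V: "x \<in> V" "y \<in> V" using assms in_arcsD1 in_arcsD2 by blast+
  then have w: "commutator_word x y \<in> words V" by (simp add: commutator_word_def)
  have gen: "gen = (\<lambda>x. word_class V ?R [(x, True)])" by (simp add: pc_gen_def fun_eq_iff)
  have "word_eval PC gen (commutator_word x y) = word_class V ?R (commutator_word x y)"
    unfolding gen pc_group_def using word_eval_word_class[OF w] .
  also have "\<dots> = word_class V ?R []"
    using assms w by (subst word_class_eq_iff) (auto intro!: pres_eq.relator)
  also have "\<dots> = \<one>\<^bsub>PC\<^esub>" by (simp add: pc_group_def presented_group_def)
  finally show ?thesis using PC.word_eval_commutator_word[of gen x y] V by simp
qed

lemma pc_group_hom: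
  assumes "group H" "f \<in> V \<rightarrow> carrier H"
    and comm: "\<And>x y. (x, y) \<in> parcs \<Gamma> \<Longrightarrow> f x \<otimes>\<^bsub>H\<^esub> f y = f y \<otimes>\<^bsub>H\<^esub> f x"
  shows "\<exists>h\<in>hom PC H. \<forall>x\<in>V. h (gen x) = f x"
  unfolding pc_group_def pc_gen_def
proof (rule presented_group_hom[OF assms(1,2)])
  interpret H: group H by fact
  fix r assume "r \<in> {commutator_word x y | x y. (x, y) \<in> parcs \<Gamma>}"
  then obtain x y where xy: "(x, y) \<in> parcs \<Gamma>" "r = commutator_word x y" by blast
  then have "f x \<in> carrier H" "f y \<in> carrier H"
    using assms(2) in_arcsD1 in_arcsD2 by (auto simp: Pi_iff)
  then show "word_eval H f r = \<one>\<^bsub>H\<^esub>" using H.word_eval_commutator_word[of f x y] comm[OF xy(1)] xy(2) by simp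
qed

text \<open>
  Sending the generators outside \<open>A\<close> to the identity respects the commutation relations, whatever \<open>A\<close>
  is. This is the retraction of the group onto \<open>G(A)\<close>.
\<close>

lemma ex_retraction:
  "\<exists>r\<in>hom PC PC. (\<forall>x\<in>V. r (gen x) = (if x \<in> A then gen x else \<one>\<^bsub>PC\<^esub>))"
proof (rule pc_group_hom[OF PC.is_group])
  show "(\<lambda>x. if x \<in> A then gen x else \<one>\<^bsub>PC\<^esub>) \<in> V \<rightarrow> carrier PC" by auto
qed (use gen_commute in_arcsD1 in_arcsD2 in auto)

lemma retraction_image:
  assumes "r \<in> hom PC PC" "\<forall>x\<in>V. r (gen x) = (if x \<in> A then gen x else \<one>\<^bsub>PC\<^esub>)"
    and "B \<subseteq> V" "g \<in> sub B"
  shows "r g \<in> sub (A \<inter> B)"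
proof -
  interpret r: group_hom PC PC r using assms(1) by unfold_locales
  interpret AB: subgroup "sub (A \<inter> B)" PC using assms(3) by (intro subgroup_sub) blast
  have "r ` generate PC (gen ` B) = generate PC (r ` gen ` B)"
    using r.generate_img[OF gen_image_subset[OF assms(3)]] by simp
  also have "\<dots> \<subseteq> sub (A \<inter> B)"
  proof (rule PC.generate_subgroup_incl[OF _ AB.subgroup_axioms])
    have "r (gen y) \<in> sub (A \<inter> B)" if "y \<in> B" for y
      using assms(2,3) that gen_in_sub[of y "A \<inter> B"] AB.one_closed by (cases "y \<in> A") auto
    then show "r ` gen ` B \<subseteq> sub (A \<inter> B)" by blast
  qed
  finally show ?thesis using assms(4) unfolding pc_subgroup_def by blast
qed

lemma retraction_id:
  assumes "r \<in> hom PC PC" "\<forall>x\<in>V. r (gen x) = (if x \<in> A then gen x else \<one>\<^bsub>PC\<^esub>)"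
    and "A \<subseteq> V" "g \<in> sub A"
  shows "r g = g"
proof (rule PC.hom_eq_on_generate[OF PC.is_group assms(1)])
  show "(\<lambda>a. a) \<in> hom PC PC" by (simp add: hom_def)
  show "gen ` A \<subseteq> carrier PC" by (rule gen_image_subset) fact
  show "r s = s" if "s \<in> gen ` A" for s using that assms(2,3) by auto
qed (use assms(4) in \<open>simp add: pc_subgroup_def\<close>)

text \<open>
  The retraction onto \<open>G(A)\<close> fixes the elements of \<open>G(A)\<close> and maps \<open>G(B)\<close> into \<open>G(A \<inter> B)\<close>.
\<close>

lemma sub_Int:
  assumes "A \<subseteq> V" "B \<subseteq> V"
  shows "sub A \<inter> sub B \<subseteq> sub (A \<inter> B)"
proof
  fix g assume g: "g \<in> sub A \<inter> sub B"
  obtain r where r: "r \<in> hom PC PC" "\<forall>x\<in>V. r (gen x) = (if x \<in> A then gen x else \<one>\<^bsub>PC\<^esub>)"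
    using ex_retraction by blast
  show "g \<in> sub (A \<inter> B)"
    using retraction_image[OF r, of B g] retraction_id[OF r, of g] assms g by simp
qed

text \<open>
  The distance is an infimum in the extended reals. Walks of unit cost arcs have natural numbers as
  costs, so an infimum below \<open>2\<close> yields a walk with at most one arc.
\<close>

lemma graph_dist_le_one_iff:
  assumes "u \<in> V"
  shows "graph_dist \<Gamma> u v \<le> 1 \<longleftrightarrow> u = v \<or> (u, v) \<in> parcs \<Gamma>"
proof
  assume "graph_dist \<Gamma> u v \<le> 1"
  then have "(INF p\<in>{p. awalk u p v}. ereal (awalk_cost (\<lambda>_. 1) p)) < 2"
    unfolding graph_dist_def \<mu>_def by (rule le_less_trans) simp
  then obtain p where p: "awalk u p v" "ereal (awalk_cost (\<lambda>_. 1) p) < 2"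
    by (auto simp: INF_less_iff)
  have "awalk_cost (\<lambda>_. 1) q = length q" for q :: "('a \<times> 'a) list"
    by (induction q) auto
  then have "length p < 2" using p(2) by simp
  then consider "p = []" | e where "p = [e]"
    by (cases p; cases "tl p") auto
  then show "u = v \<or> (u, v) \<in> parcs \<Gamma>"
    using p(1) by cases (auto simp: awalk_Nil_iff awalk_Cons_iff)
next
  assume "u = v \<or> (u, v) \<in> parcs \<Gamma>"
  then have "awalk u [] v \<or> awalk u [(u, v)] v"
    using assms by (auto simp: awalk_Nil_iff awalk_Cons_iff in_arcsD2)
  then show "graph_dist \<Gamma> u v \<le> 1"
    unfolding graph_dist_def
    using min_cost_le_walk_cost[of u "[]" v "\<lambda>_. 1"] min_cost_le_walk_cost[of u "[(u, v)]" v "\<lambda>_. 1"]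
    by (auto simp: one_ereal_def elim!: order_trans)
qed

lemma mem_perp_iff: "u \<in> perp \<Gamma> Y \<longleftrightarrow> u \<in> V \<and> (\<forall>y\<in>Y. u = y \<or> (u, y) \<in> parcs \<Gamma>)"
  unfolding perp_def using graph_dist_le_one_iff by auto

lemma perp_subset: "perp \<Gamma> Y \<subseteq> V"
  by (auto simp: perp_def)

lemma gen_commute_perp:
  assumes "u \<in> perp \<Gamma> Y" "y \<in> Y"
  shows "gen u \<otimes>\<^bsub>PC\<^esub> gen y = gen y \<otimes>\<^bsub>PC\<^esub> gen u"
  using assms gen_commute[of u y] by (auto simp only: mem_perp_iff)

text \<open>
  Let \<open>E = G(st x)\<close>. The group acts on \<open>G \<times> bool\<close> by left multiplication on the first component, where
  in addition \<open>x\<close> flips the bit at the points over \<open>E\<close>. The relations are respected because \<open>E\<close> is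
  closed under left multiplication by the neighbours of \<open>x\<close>. The map \<open>t\<close> that multiplies by \<open>x\<close> from
  the right and flips the bit commutes with the action, because \<open>E\<close> is closed under right
  multiplication by \<open>x\<close>; and it agrees with the action of \<open>x\<close> at \<open>(1, False)\<close>. Let \<open>g\<close> carry
  \<open>(1, False)\<close> to \<open>(g, i)\<close>. Then \<open>gx\<close> carries it to \<open>t(g, i)\<close>, with the bit flipped, whereas \<open>xg\<close>
  carries it to the image of \<open>(g, i)\<close> under \<open>x\<close>, where the bit is flipped only if \<open>g\<close> lies in \<open>E\<close>.
  Since \<open>gx = xg\<close>, it does.
\<close>

lemma centralizer_gen:
  assumes x: "x \<in> V" and g: "g \<in> carrier PC" and comm: "g \<otimes>\<^bsub>PC\<^esub> gen x = gen x \<otimes>\<^bsub>PC\<^esub> g"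
  shows "g \<in> sub (perp \<Gamma> {x})"
proof -
  define E where "E = sub (perp \<Gamma> {x})"
  define \<Omega> where "\<Omega> = carrier PC \<times> (UNIV :: bool set)"
  define f where "f y = (\<lambda>(h, i)\<in>\<Omega>. (gen y \<otimes>\<^bsub>PC\<^esub> h, if y = x \<and> h \<in> E then \<not> i else i))" for y
  define t where "t = (\<lambda>(h, i)\<in>\<Omega>. (h \<otimes>\<^bsub>PC\<^esub> gen x, \<not> i))"
  let ?B = "BijGroup \<Omega>"
  interpret B: group ?B by (rule group_BijGroup)
  have f: "f y (h, i) = (gen y \<otimes>\<^bsub>PC\<^esub> h, if y = x \<and> h \<in> E then \<not> i else i)" if "h \<in> carrier PC" for y h i
    using that by (simp add: f_def \<Omega>_def)
  have t: "t (h, i) = (h \<otimes>\<^bsub>PC\<^esub> gen x, \<not> i)" if "h \<in> carrier PC" for h i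
    using that by (simp add: t_def \<Omega>_def)
  have xstar: "x \<in> perp \<Gamma> {x}" using x by (simp add: mem_perp_iff)
  have E_left: "gen y \<otimes>\<^bsub>PC\<^esub> h \<in> E \<longleftrightarrow> h \<in> E" if "y \<in> perp \<Gamma> {x}" "h \<in> carrier PC" for y h
    unfolding E_def using mem_sub_mult_left gen_in_sub perp_subset that by blast
  have E_right: "h \<otimes>\<^bsub>PC\<^esub> gen x \<in> E \<longleftrightarrow> h \<in> E" if "h \<in> carrier PC" for h
    unfolding E_def using mem_sub_mult_right gen_in_sub perp_subset xstar that by blast
  have Bij: "k \<in> Bij \<Omega>" if "k \<in> extensional \<Omega>" "bij_betw k \<Omega> \<Omega>" for k
    using that by (simp add: Bij_def)
  have fB: "f y \<in> carrier ?B" if y: "y \<in> V" for y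
  proof -
    have "bij_betw (f y) \<Omega> \<Omega>"
      by (rule bij_betw_byWitness[where f' = "\<lambda>(h, i). (inv\<^bsub>PC\<^esub> gen y \<otimes>\<^bsub>PC\<^esub> h,
            if y = x \<and> inv\<^bsub>PC\<^esub> gen y \<otimes>\<^bsub>PC\<^esub> h \<in> E then \<not> i else i)"])
        (use y in \<open>auto simp: f \<Omega>_def PC.m_assoc[symmetric]\<close>)
    then show ?thesis using Bij by (simp add: BijGroup_def f_def)
  qed
  have tB: "t \<in> carrier ?B"
  proof -
    have "bij_betw t \<Omega> \<Omega>"
      by (rule bij_betw_byWitness[where f' = "\<lambda>(h, i). (h \<otimes>\<^bsub>PC\<^esub> inv\<^bsub>PC\<^esub> gen x, \<not> i)"])
        (use x in \<open>auto simp: t \<Omega>_def PC.m_assoc\<close>)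
    then show ?thesis using Bij by (simp add: BijGroup_def t_def)
  qed
  have B_mult: "k \<otimes>\<^bsub>?B\<^esub> l = compose \<Omega> k l" if "k \<in> carrier ?B" "l \<in> carrier ?B" for k l
    using that by (simp add: BijGroup_def)
  have "f y \<otimes>\<^bsub>?B\<^esub> f z = f z \<otimes>\<^bsub>?B\<^esub> f y" if yz: "(y, z) \<in> parcs \<Gamma>" for y z
  proof -
    have V: "y \<in> V" "z \<in> V" "(z, y) \<in> parcs \<Gamma>"
      using yz in_arcsD1 in_arcsD2 arcs_symmetric by blast+
    then have star: "y = x \<Longrightarrow> z \<in> perp \<Gamma> {x}" "z = x \<Longrightarrow> y \<in> perp \<Gamma> {x}"
      using yz by (auto simp: mem_perp_iff)
    have "compose \<Omega> (f y) (f z) p = compose \<Omega> (f z) (f y) p" for p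
    proof (cases "p \<in> \<Omega>")
      case True
      then obtain h i where p: "p = (h, i)" "h \<in> carrier PC" by (auto simp: \<Omega>_def)
      have "gen y \<otimes>\<^bsub>PC\<^esub> (gen z \<otimes>\<^bsub>PC\<^esub> h) = gen z \<otimes>\<^bsub>PC\<^esub> (gen y \<otimes>\<^bsub>PC\<^esub> h)"
        using gen_commute[OF yz] p V by (simp add: PC.m_assoc[symmetric])
      then show ?thesis using True p V star E_left by (auto simp: compose_def f)
    qed (simp add: compose_def)
    then show ?thesis using B_mult fB V by (simp add: fun_eq_iff)
  qed
  then obtain \<rho> where \<rho>: "\<rho> \<in> hom PC ?B" "\<And>y. y \<in> V \<Longrightarrow> \<rho> (gen y) = f y"
    using pc_group_hom[OF B.is_group, of f] fB by blast
  interpret \<rho>: group_hom PC ?B \<rho> using \<rho>(1) by unfold_locales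
  have \<rho>_mult: "\<rho> (a \<otimes>\<^bsub>PC\<^esub> b) p = \<rho> a (\<rho> b p)" if "a \<in> carrier PC" "b \<in> carrier PC" "p \<in> \<Omega>" for a b p
    using that by (simp add: B_mult compose_def)
  have \<rho>_\<Omega>: "\<rho> a p \<in> \<Omega>" if "a \<in> carrier PC" "p \<in> \<Omega>" for a p
    using \<rho>.hom_closed[OF that(1)] that(2) by (auto simp: BijGroup_def dest!: Bij_imp_funcset)
  have \<rho>_one: "\<rho> \<one>\<^bsub>PC\<^esub> p = p" if "p \<in> \<Omega>" for p
    using that by (simp add: BijGroup_def)
  have fst_\<rho>: "fst (\<rho> a p) = a \<otimes>\<^bsub>PC\<^esub> fst p" if "a \<in> generate PC (gen ` V)" "p \<in> \<Omega>" for a p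
    using that
  proof (induction arbitrary: p)
    case one
    then show ?case by (auto simp: \<rho>_one \<Omega>_def simp del: \<rho>.hom_one)
  next
    case (incl s)
    then show ?case by (auto simp: \<rho> f \<Omega>_def)
  next
    case (inv s)
    then obtain y where y: "y \<in> V" "s = gen y" by blast
    \<comment> \<open>the action of \<open>s\<close> is known, so the point reached by \<open>inv s\<close> is read off by applying \<open>s\<close> to it\<close>
    obtain k j where kj: "\<rho> (inv\<^bsub>PC\<^esub> s) p = (k, j)" by force
    then have k: "k \<in> carrier PC" "(k, j) \<in> \<Omega>" using \<rho>_\<Omega>[of "inv\<^bsub>PC\<^esub> s" p] inv y by (auto simp: \<Omega>_def)
    have "p = \<rho> s (\<rho> (inv\<^bsub>PC\<^esub> s) p)"
      using \<rho>_mult[of s "inv\<^bsub>PC\<^esub> s" p] \<rho>_one inv y by (simp del: \<rho>.hom_mult \<rho>.hom_one \<rho>.hom_inv)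
    also have "\<dots> = f y (k, j)" using kj y \<rho> by simp
    finally have "fst p = s \<otimes>\<^bsub>PC\<^esub> k" using k y by (simp add: f)
    then show ?case using kj k y by (simp add: PC.m_assoc[symmetric])
  next
    case (eng a b)
    then have ab: "a \<in> carrier PC" "b \<in> carrier PC" using pc_group_generated by auto
    then have "fst p \<in> carrier PC" using eng by (auto simp: \<Omega>_def)
    then show ?case
      using eng ab \<rho>_\<Omega> by (simp add: \<rho>_mult PC.m_assoc del: \<rho>.hom_mult)
  qed
  have "f y \<otimes>\<^bsub>?B\<^esub> t = t \<otimes>\<^bsub>?B\<^esub> f y" if y: "y \<in> V" for y
  proof -
    have "compose \<Omega> (f y) t p = compose \<Omega> t (f y) p" for p
      using x y E_right by (cases "p \<in> \<Omega>") (auto simp: compose_def f t \<Omega>_def PC.m_assoc)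
    then show ?thesis using B_mult fB tB y by (simp add: fun_eq_iff)
  qed
  moreover have "\<rho> g \<in> generate ?B (f ` V)"
  proof -
    have "\<rho> g \<in> \<rho> ` generate PC (gen ` V)" using g pc_group_generated by blast
    also have "\<dots> = generate ?B (\<rho> ` gen ` V)" by (rule \<rho>.generate_img[symmetric]) auto
    also have "\<rho> ` gen ` V = f ` V" using \<rho> by (auto simp: image_image)
    finally show ?thesis .
  qed
  ultimately have \<rho>t: "\<rho> g \<otimes>\<^bsub>?B\<^esub> t = t \<otimes>\<^bsub>?B\<^esub> \<rho> g"
    using B.commutes_generate[of "f ` V" t "\<rho> g"] fB tB by blast
  let ?p = "(\<one>\<^bsub>PC\<^esub>, False)"
  have p: "?p \<in> \<Omega>" by (simp add: \<Omega>_def)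
  obtain i where gi: "\<rho> g ?p = (g, i)"
    using fst_\<rho>[of g ?p] g p pc_group_generated by (cases "\<rho> g ?p") auto
  have "\<one>\<^bsub>PC\<^esub> \<in> E" unfolding E_def pc_subgroup_def by (rule generate.one)
  then have "\<rho> (gen x) ?p = t ?p" using \<rho>(2)[OF x] x by (simp add: f t)
  then have "\<rho> (g \<otimes>\<^bsub>PC\<^esub> gen x) ?p = \<rho> g (t ?p)"
    using \<rho>_mult[of g "gen x" ?p] g x p by simp
  also have "\<dots> = t (\<rho> g ?p)"
    using fun_cong[OF \<rho>t, of ?p] B_mult[OF _ tB] B_mult[OF tB] g p by (simp add: compose_def)
  also have "\<dots> = (g \<otimes>\<^bsub>PC\<^esub> gen x, \<not> i)" using gi t g by simp
  finally have "(g \<otimes>\<^bsub>PC\<^esub> gen x, \<not> i) = \<rho> (gen x \<otimes>\<^bsub>PC\<^esub> g) ?p" using comm by simp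
  also have "\<dots> = f x (g, i)" using \<rho>_mult[of "gen x" g ?p] g x p gi \<rho>(2) by simp
  finally have "(g \<otimes>\<^bsub>PC\<^esub> gen x, \<not> i) = f x (g, i)" .
  then have "g \<in> E" using f[OF g, of x i] by (auto split: if_splits)
  then show ?thesis unfolding E_def .
qed

lemma centralizer_gens:
  assumes "L \<subseteq> V" "g \<in> carrier PC"
  shows "g \<in> sub (perp \<Gamma> L) \<longleftrightarrow> (\<forall>u\<in>L. g \<otimes>\<^bsub>PC\<^esub> gen u = gen u \<otimes>\<^bsub>PC\<^esub> g)"
proof
  assume "g \<in> sub (perp \<Gamma> L)"
  then show "\<forall>u\<in>L. g \<otimes>\<^bsub>PC\<^esub> gen u = gen u \<otimes>\<^bsub>PC\<^esub> g"
    using assms(1) commutes_sub[OF perp_subset gen_closed gen_commute_perp] by (meson subsetD)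
next
  have "finite L" using assms(1) pair_finite_verts finite_subset by blast
  then show "g \<in> sub (perp \<Gamma> L)" if "\<forall>u\<in>L. g \<otimes>\<^bsub>PC\<^esub> gen u = gen u \<otimes>\<^bsub>PC\<^esub> g"
    using that assms(1)
  proof (induction L)
    case empty
    have "perp \<Gamma> {} = V" by (simp add: perp_def)
    then show ?case using assms(2) pc_group_generated by (simp add: pc_subgroup_def)
  next
    case (insert u L)
    have "perp \<Gamma> (insert u L) = perp \<Gamma> {u} \<inter> perp \<Gamma> L" by (auto simp: perp_def)
    moreover have "g \<in> sub (perp \<Gamma> {u})" using insert assms(2) by (intro centralizer_gen) auto
    ultimately show ?case using insert sub_Int[OF perp_subset perp_subset] by auto
  qed
qed

section \<open>Basis-conjugating automorphisms and stars\<close>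

text \<open>
  \<open>G(lk x)\<close> is normal in \<open>G(st x)\<close>, since \<open>x\<close> itself commutes with \<open>lk x\<close>.
\<close>

lemma conj_star_preserves_link:
  assumes x: "x \<in> V" and k: "k \<in> sub (perp \<Gamma> {x})" and a: "a \<in> sub (perp \<Gamma> {x} - {x})"
  shows "conj_elt PC a k \<in> sub (perp \<Gamma> {x} - {x})"
proof -
  let ?L = "perp \<Gamma> {x} - {x}"
  have L: "?L \<subseteq> V" using perp_subset by auto
  interpret L: subgroup "sub ?L" PC by (rule subgroup_sub[OF L])
  have in_L: "conj_elt PC a s \<in> sub ?L" if "s \<in> sub ?L" "a \<in> sub ?L" for s a
    using that by (simp add: conj_elt_def)
  have x_comm: "a \<otimes>\<^bsub>PC\<^esub> gen x = gen x \<otimes>\<^bsub>PC\<^esub> a" if "a \<in> sub ?L" for a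
    using commutes_sub[OF L gen_closed[OF x] _ that] gen_commute_perp[of _ "{x}" x] by simp
  have by_x: "conj_elt PC a (gen x) = a" "conj_elt PC a (inv\<^bsub>PC\<^esub> gen x) = a" if "a \<in> sub ?L" for a
  proof -
    show *: "conj_elt PC a (gen x) = a"
      using x_comm[OF that] that x by (simp add: PC.conj_elt_eq_self_iff)
    show "conj_elt PC a (inv\<^bsub>PC\<^esub> gen x) = a"
      using PC.conj_elt_cancel(1)[of a "gen x"] * that x by simp
  qed
  have gen: "conj_elt PC a (gen y) \<in> sub ?L \<and> conj_elt PC a (inv\<^bsub>PC\<^esub> gen y) \<in> sub ?L"
    if "y \<in> perp \<Gamma> {x}" "a \<in> sub ?L" for y a
    using that in_L by_x gen_in_sub[of y ?L] by (cases "y = x") auto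
  have "k \<in> generate PC (gen ` perp \<Gamma> {x})" using k by (simp add: pc_subgroup_def)
  then show ?thesis using a
  proof (induction arbitrary: a)
    case (eng h k)
    then have "h \<in> carrier PC" "k \<in> carrier PC"
      using PC.generate_in_carrier[OF gen_image_subset[OF perp_subset]] by blast+
    then show ?case
      using eng PC.conj_elt_conj_elt[of a h k, symmetric] by simp
  qed (use gen in auto)
qed

text \<open>
  The image of \<open>u\<close> commutes with \<open>x\<close> and so lies in \<open>G(st x)\<close>. Applying the retraction onto \<open>G(st x)\<close>
  to the equation \<open>\<tau>(u) = u\<^sup>k\<close> replaces \<open>k\<close> by an element of \<open>G(st x)\<close>.
\<close>

lemma basis_conjugating_fixing_preserves_link:
  assumes \<tau>: "\<tau> \<in> hom PC PC" and conj: "\<And>y. y \<in> V \<Longrightarrow> \<exists>k\<in>carrier PC. \<tau> (gen y) = conj_elt PC (gen y) k"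
    and x: "x \<in> V" "\<tau> (gen x) = gen x" and u: "u \<in> perp \<Gamma> {x} - {x}"
  shows "\<tau> (gen u) \<in> sub (perp \<Gamma> {x} - {x})"
proof -
  have uV: "u \<in> V" using u perp_subset by blast
  interpret \<tau>: group_hom PC PC \<tau> using \<tau> by unfold_locales
  obtain k where k: "k \<in> carrier PC" "\<tau> (gen u) = conj_elt PC (gen u) k" using conj[OF uV] by blast
  have "\<tau> (gen u) \<otimes>\<^bsub>PC\<^esub> gen x = gen x \<otimes>\<^bsub>PC\<^esub> \<tau> (gen u)"
    using gen_commute_perp[of u "{x}" x] u uV x by (metis DiffD1 \<tau>.hom_mult gen_closed singletonI)
  then have star: "\<tau> (gen u) \<in> sub (perp \<Gamma> {x})" using x uV by (intro centralizer_gen) auto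
  obtain r where r: "r \<in> hom PC PC"
    "\<forall>y\<in>V. r (gen y) = (if y \<in> perp \<Gamma> {x} then gen y else \<one>\<^bsub>PC\<^esub>)"
    using ex_retraction by blast
  have "\<tau> (gen u) = r (\<tau> (gen u))" using retraction_id[OF r perp_subset star] by simp
  also have "\<dots> = conj_elt PC (r (gen u)) (r k)" using PC.hom_conj_elt[OF r(1)] k uV by simp
  also have "r (gen u) = gen u" using r(2) u uV by simp
  finally have "\<tau> (gen u) = conj_elt PC (gen u) (r k)" .
  moreover have "r k \<in> sub (perp \<Gamma> {x})"
    using retraction_image[OF r order_refl, of k] k pc_group_generated perp_subset[of "{x}"]
    by (simp add: pc_subgroup_def Int_absorb2)
  ultimately show ?thesis using conj_star_preserves_link x gen_in_sub[OF u] by simp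
qed

lemma adm_singleton: "adm \<Gamma> {x} = perp \<Gamma> (perp \<Gamma> {x} - {x})"
  by (simp add: adm_def)

lemma adm_subset: "adm \<Gamma> Y \<subseteq> V"
  using perp_subset by (auto simp: adm_def)

lemma mem_adm_self: "x \<in> V \<Longrightarrow> x \<in> adm \<Gamma> {x}"
  unfolding adm_singleton by (auto simp: mem_perp_iff arcs_symmetric)

lemma Conj_eq_pointwise_inner:
  "Conj \<Gamma> = {\<phi> \<in> auto PC. \<forall>A\<in>(\<lambda>x. {gen x}) ` V. \<exists>f\<in>carrier PC. \<forall>a\<in>A. \<phi> a = conj_elt PC a f}"
  by (simp add: Conj_def)

lemma Conj_N_eq_pointwise_inner:
  "Conj_N \<Gamma> = {\<phi> \<in> auto PC. \<forall>A\<in>(\<lambda>x. gen ` adm \<Gamma> {x}) ` V.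
     \<exists>f\<in>carrier PC. \<forall>a\<in>A. \<phi> a = conj_elt PC a f}"
  using mem_adm_self by (fastforce simp: Conj_N_def Conj_def)

lemma St_conj_eq_setwise_inner:
  "St_conj \<Gamma> K = {\<phi> \<in> auto PC. \<forall>H\<in>sub ` K. \<exists>f\<in>carrier PC. \<phi> ` H = conj_set PC H f}"
  by (simp add: St_conj_def)

lemma subgroup_Conj: "subgroup (Conj \<Gamma>) (AutoGroup PC)"
  unfolding Conj_eq_pointwise_inner by (rule PC.subgroup_pointwise_inner) auto

lemma subgroup_Conj_N: "subgroup (Conj_N \<Gamma>) (AutoGroup PC)"
  unfolding Conj_N_eq_pointwise_inner
  by (rule PC.subgroup_pointwise_inner) (use adm_subset gen_image_subset in blast)

lemma subgroup_St_conj: "subgroup (St_conj \<Gamma> (admissible_sets \<Gamma>)) (AutoGroup PC)"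
  unfolding St_conj_eq_setwise_inner admissible_sets_def
  by (rule PC.subgroup_setwise_inner) (use sub_subset[OF adm_subset] in auto)

text \<open>
  Since \<open>G(\<aa>(x))\<close> is the centralizer of \<open>G(lk x)\<close>, it suffices that the product of \<open>\<phi>\<close> with the inner
  automorphism that makes it fix \<open>x\<close> has an inverse \<open>\<tau>\<close> that maps \<open>lk x\<close> into \<open>G(lk x)\<close>: if \<open>a\<close> commutes with \<open>\<tau>(u)\<close>, its image
  commutes with \<open>u\<close>.
\<close>

lemma Conj_preserves_adm:
  assumes \<phi>: "\<phi> \<in> Conj \<Gamma>" and x: "x \<in> V"
  shows "\<exists>g\<in>carrier PC. \<phi> ` sub (adm \<Gamma> {x}) \<subseteq> conj_set PC (sub (adm \<Gamma> {x})) g"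
proof -
  interpret A: group "AutoGroup PC" by (rule PC.AutoGroup)
  let ?\<theta> = "inv\<^bsub>AutoGroup PC\<^esub> \<phi>"
  let ?L = "perp \<Gamma> {x} - {x}"
  have \<phi>A: "\<phi> \<in> auto PC" using \<phi> by (simp add: Conj_def)
  have \<theta>: "?\<theta> \<in> Conj \<Gamma>" using subgroup.m_inv_closed[OF subgroup_Conj \<phi>] .
  note \<theta>A = PC.auto_inv[OF \<phi>A]
  note D = PC.autoD[OF \<phi>A] PC.autoD[OF \<theta>A(1)]
  interpret \<phi>: group_hom PC PC \<phi> using D(1) by unfold_locales
  obtain g where g: "g \<in> carrier PC" "\<phi> (gen x) = conj_elt PC (gen x) g"
    using \<phi> x by (auto simp: Conj_def)
  \<comment> \<open>the inverse of \<open>\<phi>\<close> followed by conjugation by \<open>inv g\<close>, an automorphism that fixes \<open>x\<close>\<close>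
  define \<tau> where "\<tau> = (\<lambda>a. ?\<theta> (conj_elt PC a g))"
  have \<tau>: "\<tau> \<in> hom PC PC"
    using hom_compose[OF PC.conj_elt_hom[OF g(1)] D(3)] by (simp add: \<tau>_def comp_def)
  have \<tau>x: "\<tau> (gen x) = gen x" using \<theta>A(2) g x by (simp add: \<tau>_def flip: g(2))
  have \<tau>_conj: "\<exists>k\<in>carrier PC. \<tau> (gen y) = conj_elt PC (gen y) k" if y: "y \<in> V" for y
  proof -
    obtain k where k: "k \<in> carrier PC" "?\<theta> (gen y) = conj_elt PC (gen y) k"
      using \<theta> y by (auto simp: Conj_def)
    have "\<tau> (gen y) = conj_elt PC (gen y) (k \<otimes>\<^bsub>PC\<^esub> ?\<theta> g)"
      using PC.hom_conj_elt[OF D(3), of "gen y" g] k y g D(4) by (simp add: \<tau>_def PC.conj_elt_conj_elt)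
    then show ?thesis using k g D(4) by blast
  qed
  have L: "?L \<subseteq> V" using perp_subset by auto
  have "\<phi> a \<in> conj_set PC (sub (adm \<Gamma> {x})) g" if a: "a \<in> sub (adm \<Gamma> {x})" for a
  proof -
    have aG: "a \<in> carrier PC" using a sub_subset[OF adm_subset] by blast
    let ?b = "conj_elt PC (\<phi> a) (inv\<^bsub>PC\<^esub> g)"
    have b: "?b \<in> carrier PC" using g aG by simp
    have "?b \<otimes>\<^bsub>PC\<^esub> gen u = gen u \<otimes>\<^bsub>PC\<^esub> ?b" if u: "u \<in> ?L" for u
    proof -
      have uV: "u \<in> V" using u L by blast
      let ?v = "\<tau> (gen u)"
      have v: "?v \<in> sub ?L"
        using basis_conjugating_fixing_preserves_link[OF \<tau> \<tau>_conj x \<tau>x u] by blast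
      then have vG: "?v \<in> carrier PC" using sub_subset[OF L] by blast
      have "?v \<otimes>\<^bsub>PC\<^esub> a = a \<otimes>\<^bsub>PC\<^esub> ?v"
        using centralizer_gens[OF L aG] a unfolding adm_singleton
        by (intro commutes_sub[OF L aG _ v]) simp
      then have "\<phi> a \<otimes>\<^bsub>PC\<^esub> \<phi> ?v = \<phi> ?v \<otimes>\<^bsub>PC\<^esub> \<phi> a"
        using \<phi>.hom_mult aG vG by metis
      moreover have "\<phi> ?v = conj_elt PC (gen u) g" using \<theta>A(3) g uV by (simp add: \<tau>_def)
      ultimately have "\<phi> a \<otimes>\<^bsub>PC\<^esub> conj_elt PC (gen u) g = conj_elt PC (gen u) g \<otimes>\<^bsub>PC\<^esub> \<phi> a" by simp
      moreover have "(\<lambda>a. conj_elt PC a (inv\<^bsub>PC\<^esub> g)) \<in> hom PC PC" using g by (simp add: PC.conj_elt_hom)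
      ultimately have "?b \<otimes>\<^bsub>PC\<^esub> conj_elt PC (conj_elt PC (gen u) g) (inv\<^bsub>PC\<^esub> g)
          = conj_elt PC (conj_elt PC (gen u) g) (inv\<^bsub>PC\<^esub> g) \<otimes>\<^bsub>PC\<^esub> ?b"
        using hom_mult[of "\<lambda>a. conj_elt PC a (inv\<^bsub>PC\<^esub> g)" PC PC] aG g uV
        by (metis PC.conj_elt_closed \<phi>.hom_closed gen_closed)
      then show ?thesis using g uV by simp
    qed
    then have "?b \<in> sub (adm \<Gamma> {x})" using centralizer_gens[OF L b] by (simp add: adm_singleton)
    moreover have "\<phi> a = conj_elt PC ?b g" using g aG by simp
    ultimately show ?thesis unfolding conj_set_def by blast
  qed
  then show ?thesis using g(1) by blast
qed

lemma Conj_N_inner_on_adm: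
  assumes "\<psi> \<in> Conj_N \<Gamma>" "x \<in> V"
  shows "\<exists>k\<in>carrier PC. \<forall>h\<in>sub (adm \<Gamma> {x}). \<psi> h = conj_elt PC h k"
proof -
  have \<psi>: "\<psi> \<in> hom PC PC" using assms PC.autoD by (auto simp: Conj_N_def Conj_def)
  obtain k where k: "k \<in> carrier PC" "\<forall>y\<in>adm \<Gamma> {x}. \<psi> (gen y) = conj_elt PC (gen y) k"
    using assms by (auto simp: Conj_N_def)
  then show ?thesis
    using PC.pointwise_inner_generate[OF \<psi> gen_image_subset[OF adm_subset]]
    unfolding pc_subgroup_def by blast
qed

lemma conjugate_Conj_N:
  assumes \<phi>: "\<phi> \<in> auto PC" and \<psi>: "\<psi> \<in> Conj_N \<Gamma>"
    and img: "\<And>x. x \<in> V \<Longrightarrow>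
      \<exists>f\<in>carrier PC. \<phi> ` sub (adm \<Gamma> {x}) \<subseteq> conj_set PC (sub (adm \<Gamma> {x})) f"
  shows "inv\<^bsub>AutoGroup PC\<^esub> \<phi> \<otimes>\<^bsub>AutoGroup PC\<^esub> \<psi> \<otimes>\<^bsub>AutoGroup PC\<^esub> \<phi> \<in> Conj_N \<Gamma>"
proof -
  interpret A: group "AutoGroup PC" by (rule PC.AutoGroup)
  let ?\<theta> = "inv\<^bsub>AutoGroup PC\<^esub> \<phi>"
  let ?\<chi> = "?\<theta> \<otimes>\<^bsub>AutoGroup PC\<^esub> \<psi> \<otimes>\<^bsub>AutoGroup PC\<^esub> \<phi>"
  have \<psi>A: "\<psi> \<in> auto PC" using \<psi> by (simp add: Conj_N_def Conj_def)
  note \<theta>A = PC.auto_inv(1)[OF \<phi>]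
  have \<chi>A: "?\<chi> \<in> auto PC" "?\<theta> \<otimes>\<^bsub>AutoGroup PC\<^esub> \<psi> \<in> auto PC"
    using A.m_closed \<phi> \<psi>A \<theta>A by simp_all
  have \<chi>: "?\<chi> a = ?\<theta> (\<psi> (\<phi> a))" if "a \<in> carrier PC" for a
    unfolding PC.auto_mult[OF \<chi>A(2) \<phi>] unfolding PC.auto_mult[OF \<theta>A \<psi>A]
    using that PC.autoD(2)[OF \<phi> that] by (simp add: compose_def)
  have "\<exists>m\<in>carrier PC. \<forall>a\<in>gen ` adm \<Gamma> {x}. ?\<chi> a = conj_elt PC a m" if x: "x \<in> V" for x
  proof -
    let ?H = "sub (adm \<Gamma> {x})"
    have A: "gen ` adm \<Gamma> {x} \<subseteq> carrier PC" using gen_image_subset[OF adm_subset] .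
    obtain f where f: "f \<in> carrier PC" "\<phi> ` ?H \<subseteq> conj_set PC ?H f" using img[OF x] by blast
    obtain k where k: "k \<in> carrier PC" "\<forall>h\<in>?H. \<psi> h = conj_elt PC h k"
      using Conj_N_inner_on_adm[OF \<psi> x] by blast
    have "\<exists>m\<in>carrier PC. \<forall>a\<in>gen ` adm \<Gamma> {x}. ?\<theta> (\<psi> (\<phi> a)) = conj_elt PC a m"
    proof (rule PC.conjugate_pointwise_inner[OF \<phi> \<psi>A A sub_subset[OF adm_subset] f(1) k(1)])
      show "\<phi> a \<in> conj_set PC ?H f" if "a \<in> gen ` adm \<Gamma> {x}" for a
        using f(2) that gen_in_sub by blast
      show "\<psi> h = conj_elt PC h k" if "h \<in> ?H" for h
        using k(2) that by simp
    qed
    moreover have "?\<chi> a = ?\<theta> (\<psi> (\<phi> a))" if "a \<in> gen ` adm \<Gamma> {x}" for a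
      using \<chi> A that by blast
    ultimately show ?thesis by simp
  qed
  then show ?thesis using \<chi>A(1) by (auto simp: Conj_N_eq_pointwise_inner)
qed

lemma Conj_N_subset_St_conj: "Conj_N \<Gamma> \<subseteq> St_conj \<Gamma> (admissible_sets \<Gamma>)"
proof
  fix \<psi> assume \<psi>: "\<psi> \<in> Conj_N \<Gamma>"
  then have \<psi>A: "\<psi> \<in> auto PC" by (simp add: Conj_N_def Conj_def)
  have "\<exists>f\<in>carrier PC. \<psi> ` sub (adm \<Gamma> Y) = conj_set PC (sub (adm \<Gamma> Y)) f" if Y: "Y \<subseteq> V" for Y
  proof (cases "Y = {}")
    case True
    then have "sub (adm \<Gamma> Y) = carrier PC" by (simp add: adm_def pc_subgroup_def pc_group_generated)
    moreover have "\<psi> ` carrier PC = carrier PC"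
      using \<psi>A by (auto simp: auto_def Bij_def bij_betw_def)
    ultimately show ?thesis using PC.conj_set_one[of "carrier PC"] by (intro bexI[of _ "\<one>\<^bsub>PC\<^esub>"]) auto
  next
    case False
    then obtain y where y: "y \<in> Y" by blast
    then have "adm \<Gamma> Y \<subseteq> adm \<Gamma> {y}" by (auto simp: adm_def)
    then have "sub (adm \<Gamma> Y) \<subseteq> sub (adm \<Gamma> {y})"
      unfolding pc_subgroup_def by (intro PC.mono_generate) blast
    moreover obtain k where "k \<in> carrier PC" "\<forall>h\<in>sub (adm \<Gamma> {y}). \<psi> h = conj_elt PC h k"
      using Conj_N_inner_on_adm[OF \<psi>] y Y by blast
    ultimately show ?thesis unfolding conj_set_def by (intro bexI[of _ k] image_cong) auto
  qed
  then show "\<psi> \<in> St_conj \<Gamma> (admissible_sets \<Gamma>)"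
    using \<psi>A by (auto simp: St_conj_def admissible_sets_def)
qed

lemma Conj_N_normal_St_conj:
  "Conj_N \<Gamma> \<lhd> (AutoGroup PC)\<lparr>carrier := St_conj \<Gamma> (admissible_sets \<Gamma>)\<rparr>"
proof (rule group.normal_in_subgroupI[OF PC.AutoGroup subgroup_St_conj subgroup_Conj_N Conj_N_subset_St_conj])
  fix \<phi> \<psi> assume \<phi>: "\<phi> \<in> St_conj \<Gamma> (admissible_sets \<Gamma>)" and \<psi>: "\<psi> \<in> Conj_N \<Gamma>"
  show "inv\<^bsub>AutoGroup PC\<^esub> \<phi> \<otimes>\<^bsub>AutoGroup PC\<^esub> \<psi> \<otimes>\<^bsub>AutoGroup PC\<^esub> \<phi> \<in> Conj_N \<Gamma>"
  proof (rule conjugate_Conj_N[OF _ \<psi>])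
    show "\<phi> \<in> auto PC" using \<phi> by (simp add: St_conj_def)
    fix x assume "x \<in> V"
    then have "adm \<Gamma> {x} \<in> admissible_sets \<Gamma>" by (auto simp: admissible_sets_def)
    then show "\<exists>f\<in>carrier PC. \<phi> ` sub (adm \<Gamma> {x}) \<subseteq> conj_set PC (sub (adm \<Gamma> {x})) f"
      using \<phi> by (fastforce simp: St_conj_def)
  qed
qed

lemma Conj_N_normal_Conj: "Conj_N \<Gamma> \<lhd> (AutoGroup PC)\<lparr>carrier := Conj \<Gamma>\<rparr>"
proof (rule group.normal_in_subgroupI[OF PC.AutoGroup subgroup_Conj subgroup_Conj_N])
  show "Conj_N \<Gamma> \<subseteq> Conj \<Gamma>" by (auto simp: Conj_N_def)
  fix \<phi> \<psi> assume "\<phi> \<in> Conj \<Gamma>" "\<psi> \<in> Conj_N \<Gamma>"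
  then show "inv\<^bsub>AutoGroup PC\<^esub> \<phi> \<otimes>\<^bsub>AutoGroup PC\<^esub> \<psi> \<otimes>\<^bsub>AutoGroup PC\<^esub> \<phi> \<in> Conj_N \<Gamma>"
    using Conj_preserves_adm by (intro conjugate_Conj_N) (auto simp: Conj_def)
qed

end

theorem theorem4p5:
  fixes \<Gamma> :: "'a pair_pre_digraph"
  assumes "pair_graph \<Gamma>"
  shows "Conj_N \<Gamma> \<lhd> (AutoGroup (pc_group \<Gamma>))\<lparr>carrier := St_conj \<Gamma> (admissible_sets \<Gamma>)\<rparr>
       \<and> Conj_N \<Gamma> \<lhd> (AutoGroup (pc_group \<Gamma>))\<lparr>carrier := Conj \<Gamma>\<rparr>"
proof -
  interpret partially_commutative \<Gamma>
    using assms by (simp add: partially_commutative_def)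
  show ?thesis using Conj_N_normal_St_conj Conj_N_normal_Conj ..
qed

end
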